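(* Let $T\in\mathcal{B}_A(\mathcal{H})$, $\alpha\in[0,1]$ and $\beta\geq 0$. Then $$w_A^4(T)\leq \frac{\gamma_1}{16}\left\|T^{\sharp_A} T+TT^{\sharp_A}\right\|_A^2+ \frac{\gamma_2}{8}\left\|T^{\sharp_A} T+TT^{\sharp_A}\right\|_A\, w_A(T^2),$$ where $$\gamma_1=\frac{(2\beta+1)(1+\alpha^2)+2\alpha}{1+\beta}\quad\text{and}\quad \gamma_2=\frac{(1-\alpha)\left[2+(1+\alpha)(1+2\beta)\right]}{1+\beta}.$$
   Context: $(\mathcal{H},\langle\cdot,\cdot\rangle)$ is a nontrivial complex Hilbert space, $\mathcal{B}(\mathcal{H})$ is the algebra of bounded linear operators on $\mathcal{H}$, and $A\in\mathcal{B}(\mathcal{H})$ is a positive operator, i.e. $\langle Ax,x\rangle\ge 0$ for all $x\in\mathcal{H}$. The semi-inner product induced by $A$ is $\langle x,y\rangle_A=\langle Ax,y\rangle$, with seminorm $\|x\|_A=\sqrt{\langle x,x\rangle_A}$ on $\mathcal{H}$. $\mathcal{B}_A(\mathcal{H})=\{T\in\mathcal{B}(\mathcal{H}): \operatorname{ran}(T^*A)\subseteq\operatorname{ran}(A)\}$ is the set of operators admitting an $A$-adjoint. For $T\in\mathcal{B}_A(\mathcal{H})$, $T^{\sharp_A}=A^{\dagger}T^*A$ (with $A^\dagger$ the Moore-Penrose inverse of $A$) is the unique bounded solution $X$ of $AX=T^*A$ whose range is contained in $\overline{\operatorname{ran}(A)}$; it satisfies $\langle Tx,y\rangle_A=\langle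 x,T^{\sharp_A}y\rangle_A$ for all $x,y\in\mathcal{H}$. For $T\in\mathcal{B}_A(\mathcal{H})$, the $A$-operator seminorm is $\|T\|_A=\sup\{\|Tx\|_A: x\in\mathcal{H},\ \|x\|_A=1\}$ and the $A$-numerical radius is $w_A(T)=\sup\{|\langle Tx,x\rangle_A|: x\in\mathcal{H},\ \|x\|_A=1\}$; $w_A^s(T)$ means $(w_A(T))^s$. *)

theory Defs
  imports "HOL-Analysis.Analysis"
begin

text \<open>
  Complex Hilbert spaces. The inner product is linear in its \<^emph>\<open>first\<close> argument; norm, metric and
  completeness come from \<^class>\<open>banach\<close>, the norm being the one induced by the inner product.
\<close>

class complex_hilbert_space = banach +
  fixes scaleC :: "complex \<Rightarrow> 'a \<Rightarrow> 'a"  (infixr \<open>*\<^sub>C\<close> 75)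
    and cinner :: "'a \<Rightarrow> 'a \<Rightarrow> complex"
  assumes scaleC_add_right: "c *\<^sub>C (x + y) = c *\<^sub>C x + c *\<^sub>C y"
    and scaleC_add_left: "(c + d) *\<^sub>C x = c *\<^sub>C x + d *\<^sub>C x"
    and scaleC_scaleC: "c *\<^sub>C (d *\<^sub>C x) = (c * d) *\<^sub>C x"
    and scaleR_scaleC: "r *\<^sub>R x = complex_of_real r *\<^sub>C x"
    and cinner_commute: "cinner x y = cnj (cinner y x)"
    and cinner_add_left: "cinner (x + y) z = cinner x z + cinner y z"
    and cinner_scaleC_left: "cinner (c *\<^sub>C x) y = c * cinner x y"
    and cinner_self_nonneg: "cinner x x \<in> \<real>\<^sub>\<ge>\<^sub>0"
    and cinner_self_eq_zero: "cinner x x = 0 \<longleftrightarrow> x = 0"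
    and norm_eq_sqrt_cinner: "norm x = sqrt (Re (cinner x x))"

instantiation complex :: complex_hilbert_space
begin

definition scaleC_complex :: "complex \<Rightarrow> complex \<Rightarrow> complex"
  where "scaleC_complex c x = c * x"

definition cinner_complex :: "complex \<Rightarrow> complex \<Rightarrow> complex"
  where "cinner_complex x y = x * cnj y"

instance
proof
  fix x :: complex
  show "cinner x x \<in> \<real>\<^sub>\<ge>\<^sub>0"
    by (simp add: cinner_complex_def complex_nonneg_Reals_iff)
  show "norm x = sqrt (Re (cinner x x))"
    by (simp add: cinner_complex_def cmod_def power2_eq_square)
qed (simp_all add: scaleC_complex_def cinner_complex_def distrib_left distrib_right
    scaleR_conv_of_real mult.assoc)

end

definition bounded_clinear :: "('a::complex_hilbert_space \<Rightarrow> 'a) \<Rightarrow> bool"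
  where "bounded_clinear T \<longleftrightarrow> bounded_linear T \<and> (\<forall>c x. T (c *\<^sub>C x) = c *\<^sub>C T x)"

definition positive_op :: "('a::complex_hilbert_space \<Rightarrow> 'a) \<Rightarrow> bool"
  where "positive_op A \<longleftrightarrow> bounded_clinear A \<and> (\<forall>x. cinner (A x) x \<in> \<real>\<^sub>\<ge>\<^sub>0)"

definition hadjoint :: "('a::complex_hilbert_space \<Rightarrow> 'a) \<Rightarrow> 'a \<Rightarrow> 'a"
  where "hadjoint T = (THE S. bounded_clinear S \<and> (\<forall>x y. cinner (T x) y = cinner x (S y)))"

definition ortho_compl :: "'a::complex_hilbert_space set \<Rightarrow> 'a set"
  where "ortho_compl S = {x. \<forall>y\<in>S. cinner x y = 0}"

text \<open>
  The Moore-Penrose inverse of \<open>A\<close> has domain \<open>ran A \<oplus> (ran A)\<^sup>\<bottom>\<close>, vanishes on \<open>(ran A)\<^sup>\<bottom>\<close>, and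
  inverts the restriction of \<open>A\<close> to \<open>(ker A)\<^sup>\<bottom>\<close>. So it maps \<open>y = A x + z\<close>, with \<open>x \<in> (ker A)\<^sup>\<bottom>\<close> and
  \<open>z \<in> (ran A)\<^sup>\<bottom>\<close>, to \<open>x\<close>. Outside that domain the value below is unspecified.
\<close>

definition moore_penrose :: "('a::complex_hilbert_space \<Rightarrow> 'a) \<Rightarrow> 'a \<Rightarrow> 'a"
  where "moore_penrose A y =
    (THE x. x \<in> ortho_compl {u. A u = 0} \<and> y - A x \<in> ortho_compl (range A))"

definition A_inner :: "('a::complex_hilbert_space \<Rightarrow> 'a) \<Rightarrow> 'a \<Rightarrow> 'a \<Rightarrow> complex"
  where "A_inner A x y = cinner (A x) y"

definition A_norm :: "('a::complex_hilbert_space \<Rightarrow> 'a) \<Rightarrow> 'a \<Rightarrow> real"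
  where "A_norm A x = sqrt (Re (A_inner A x x))"

definition A_adjointable :: "('a::complex_hilbert_space \<Rightarrow> 'a) \<Rightarrow> ('a \<Rightarrow> 'a) set"
  where "A_adjointable A = {T. bounded_clinear T \<and> range (hadjoint T \<circ> A) \<subseteq> range A}"

definition A_adjoint :: "('a::complex_hilbert_space \<Rightarrow> 'a) \<Rightarrow> ('a \<Rightarrow> 'a) \<Rightarrow> 'a \<Rightarrow> 'a"
  where "A_adjoint A T = moore_penrose A \<circ> hadjoint T \<circ> A"

text \<open>
  The suprema are taken in \<open>[0,\<infinity>)\<close>: inserting \<open>0\<close> only matters when \<open>A = 0\<close>, where no vector has
  \<open>A\<close>-norm \<open>1\<close> and the supremum of the empty set is \<open>0\<close>.
\<close>

definition A_opnorm :: "('a::complex_hilbert_space \<Rightarrow> 'a) \<Rightarrow> ('a \<Rightarrow> 'a) \<Rightarrow> real"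
  where "A_opnorm A T = Sup (insert 0 {A_norm A (T x) |x. A_norm A x = 1})"

definition A_numrad :: "('a::complex_hilbert_space \<Rightarrow> 'a) \<Rightarrow> ('a \<Rightarrow> 'a) \<Rightarrow> real"
  where "A_numrad A T = Sup (insert 0 {cmod (A_inner A (T x) x) |x. A_norm A x = 1})"

end

theory Submission
  imports Defs
begin

text \<open>
  Write \<open>S\<close> for the \<open>A\<close>-adjoint of \<open>T\<close>, \<open>N\<close> for the \<open>A\<close>-seminorm of \<open>S T + T S\<close>, \<open>w\<close> for the
  \<open>A\<close>-numerical radius of \<open>T\<close> and \<open>W\<close> for that of \<open>T\<^sup>2\<close>. For a vector \<open>x\<close> of \<open>A\<close>-norm \<open>1\<close> the
  number \<open>\<langle>T x, x\<rangle>\<^sub>A\<close> equals \<open>\<langle>x, S x\<rangle>\<^sub>A\<close>, so Buzano's refinement of the Cauchy-Schwarz inequality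
  (\<open>A_Buzano\<close>) bounds its squared modulus by half of
  \<open>\<parallel>T x\<parallel>\<^sub>A \<parallel>S x\<parallel>\<^sub>A + \<bar>\<langle>T\<^sup>2 x, x\<rangle>\<^sub>A\<bar>\<close>. Since \<open>\<parallel>T x\<parallel>\<^sub>A\<^sup>2 + \<parallel>S x\<parallel>\<^sub>A\<^sup>2 = \<langle>(S T + T S) x, x\<rangle>\<^sub>A \<le> N\<close>, this
  gives \<open>w\<^sup>2 \<le> a + b\<close> with \<open>a = N / 4\<close> and \<open>b = W / 2\<close>; the same estimate shows \<open>b \<le> a\<close>
  (\<open>A_numrad_square_bounds\<close>).

  The stated family of bounds is a weakening of \<open>w\<^sup>4 \<le> (a + b)\<^sup>2\<close>. The two coefficients satisfy
  \<open>\<gamma>\<^sub>1 + \<gamma>\<^sub>2 = 4\<close> and \<open>\<gamma>\<^sub>2 \<le> 3\<close>, and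
  \<open>\<gamma>\<^sub>1 a\<^sup>2 + \<gamma>\<^sub>2 a b - (a + b)\<^sup>2 = (a - b) ((3 - \<gamma>\<^sub>2) a + b)\<close>, which is nonnegative
  (\<open>interpolated_square_bound\<close>).

  Most of the work is to see that the suprema defining these quantities are finite, that is, that
  an operator with an \<open>A\<close>-adjoint is bounded for the \<open>A\<close>-seminorm (\<open>A_adjoint_pair_bounded\<close>).
  Weakly bounded sets are norm bounded, and from this and the adjoint relation
  \<open>\<parallel>A T z\<parallel> \<le> M \<parallel>A z\<parallel>\<close> follows; the same bound for \<open>S\<close> comes from the boundedness of \<open>T\<close>. So the
  operator \<open>R = S T\<close>, which is symmetric for \<open>\<langle>_, _\<rangle>\<^sub>A\<close>, is bounded for the seminorm \<open>\<parallel>A _\<parallel>\<close>, and a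
  comparison of lower and upper bounds for the growth of
  \<open>\<parallel>R\<^sup>k x\<parallel>\<^sub>A\<close> turns this into boundedness for \<open>\<parallel>_\<parallel>\<^sub>A\<close> (\<open>A_norm_bound_if_symmetric\<close>). Finally,
  that the \<open>A\<close>-adjoint built from the Hilbert space adjoint and the Moore-Penrose inverse does
  satisfy \<open>\<langle>T x, y\<rangle>\<^sub>A = \<langle>x, S y\<rangle>\<^sub>A\<close> rests on orthogonal projection and the Riesz representation.
\<close>

section \<open>Inner products and the semi-inner product of a positive operator\<close>

lemma cinner_add_right: "cinner x (y + z) = cinner x y + cinner x z"
  by (metis cinner_add_left cinner_commute complex_cnj_add)

lemma cinner_scaleC_right: "cinner x (c *\<^sub>C y) = cnj c * cinner x y"
  by (metis cinner_commute cinner_scaleC_left complex_cnj_mult)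

lemma scaleC_minus_one: "(-1) *\<^sub>C x = - (x :: 'a::complex_hilbert_space)"
  by (metis of_real_1 of_real_minus scaleR_minus1_left scaleR_scaleC)

lemma scaleC_zero_right: "c *\<^sub>C 0 = (0 :: 'a::complex_hilbert_space)"
  by (metis add_cancel_right_right scaleC_add_right)

lemma cinner_minus_left: "cinner (- x) y = - cinner x y"
  by (metis cinner_scaleC_left mult_minus1 scaleC_minus_one)

lemma cinner_minus_right: "cinner x (- y) = - cinner x y"
  by (metis cinner_commute cinner_minus_left complex_cnj_minus)

lemma cinner_diff_left: "cinner (x - y) z = cinner x z - cinner y z"
  using cinner_add_left[of x "- y" z] by (simp add: cinner_minus_left)

lemma cinner_diff_right: "cinner x (y - z) = cinner x y - cinner x z"
  using cinner_add_right[of x y "- z"] by (simp add: cinner_minus_right)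

lemma cinner_zero_left: "cinner 0 y = 0"
  by (metis cinner_diff_left cancel_comm_monoid_add_class.diff_cancel)

lemma cinner_zero_right: "cinner x 0 = 0"
  by (metis cinner_diff_right cancel_comm_monoid_add_class.diff_cancel)

lemma cinner_self: "cinner x x = of_real ((norm x)\<^sup>2)"
  using cinner_self_nonneg[of x]
  by (auto simp: norm_eq_sqrt_cinner complex_nonneg_Reals_iff complex_eq_iff)

lemma bounded_clinearD:
  assumes "bounded_clinear T"
  shows "T (x + y) = T x + T y" "T (c *\<^sub>C x) = c *\<^sub>C T x" "T (x - y) = T x - T y"
    "T 0 = 0" "continuous_on X T" "T (r *\<^sub>R x) = r *\<^sub>R T x"
  using assms unfolding bounded_clinear_def
  by (auto simp: linear_simps linear_continuous_on)

text \<open>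
  The inner product of the space is the semi-inner product of the identity, so the
  Cauchy-Schwarz inequality below covers both.
\<close>
lemma positive_op_id: "positive_op (id :: 'a::complex_hilbert_space \<Rightarrow> 'a)"
  by (simp add: positive_op_def bounded_clinear_def id_def bounded_linear_ident cinner_self_nonneg)

lemma A_inner_id: "A_inner id = cinner"
  by (simp add: A_inner_def fun_eq_iff)

lemma A_norm_id: "A_norm id = norm"
  by (simp add: A_norm_def A_inner_def norm_eq_sqrt_cinner fun_eq_iff)

context
  fixes A :: "'a::complex_hilbert_space \<Rightarrow> 'a"
  assumes pos: "positive_op A"
begin

lemma A_clinear: "bounded_clinear A"
  using pos by (simp add: positive_op_def)

lemma A_inner_simps:
  "A_inner A (x + y) z = A_inner A x z + A_inner A y z"
  "A_inner A (x - y) z = A_inner A x z - A_inner A y z"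
  "A_inner A (c *\<^sub>C x) z = c * A_inner A x z"
  "A_inner A x (y + z) = A_inner A x y + A_inner A x z"
  "A_inner A x (y - z) = A_inner A x y - A_inner A x z"
  "A_inner A x (c *\<^sub>C z) = cnj c * A_inner A x z"
  using bounded_clinearD[OF A_clinear]
  by (simp_all add: A_inner_def cinner_add_left cinner_add_right cinner_diff_left
      cinner_diff_right cinner_scaleC_left cinner_scaleC_right)

lemma A_inner_self: "A_inner A x x = of_real ((A_norm A x)\<^sup>2)"
proof -
  have "A_inner A x x \<in> \<real>\<^sub>\<ge>\<^sub>0"
    using pos by (simp add: positive_op_def A_inner_def)
  then show ?thesis
    by (auto simp: A_norm_def complex_nonneg_Reals_iff complex_eq_iff)
qed

lemma cmod_A_inner_self: "cmod (A_inner A x x) = (A_norm A x)\<^sup>2"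
  unfolding A_inner_self norm_of_real by simp

lemma A_norm_nonneg: "0 \<le> A_norm A x"
  using A_inner_self[of x]
  by (metis (no_types, lifting) A_norm_def Re_complex_of_real real_sqrt_ge_zero zero_le_power2)

text \<open>
  Polarization: the forms at \<open>x + y\<close> and \<open>x + \<i> y\<close> are real, which determines the imaginary and the
  real part of \<open>\<langle>y, x\<rangle>\<^sub>A\<close>.
\<close>
lemma A_inner_commute: "A_inner A y x = cnj (A_inner A x y)"
proof -
  have r: "Im (A_inner A z z) = 0" for z
    by (simp add: A_inner_self)
  have "Im (A_inner A x y) + Im (A_inner A y x) = 0"
    using r[of "x + y"] r[of x] r[of y] by (simp add: A_inner_simps)
  moreover have "Re (A_inner A x y) = Re (A_inner A y x)"
    using r[of "x + \<i> *\<^sub>C y"] r[of x] r[of y] by (simp add: A_inner_simps)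
  ultimately show ?thesis
    by (simp add: complex_eq_iff)
qed

lemma A_selfadjoint: "cinner (A x) y = cinner x (A y)"
  using A_inner_commute[of x y] cinner_commute[of x "A y"] by (simp add: A_inner_def)

text \<open>
  The squared seminorm of \<open>x - t z y\<close> with \<open>z = \<langle>x, y\<rangle>\<^sub>A\<close> and real \<open>t\<close> is a nonnegative quadratic
  polynomial in \<open>t\<close>. When \<open>\<parallel>y\<parallel>\<^sub>A = 0\<close> it is affine, and nonnegativity forces \<open>z = 0\<close>.
\<close>
lemma A_Cauchy_Schwarz: "cmod (A_inner A x y) \<le> A_norm A x * A_norm A y"
proof -
  define z p q where "z = A_inner A x y" and "p = (A_norm A x)\<^sup>2" and "q = (A_norm A y)\<^sup>2"
  define m where "m = (cmod z)\<^sup>2"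
  have zm: "z * cnj z = of_real m"
    by (simp add: m_def complex_norm_square[symmetric])
  have pos_t: "0 \<le> p - 2 * t * m + t\<^sup>2 * m * q" for t :: real
  proof -
    let ?c = "of_real t * z"
    have "of_real ((A_norm A (x - ?c *\<^sub>C y))\<^sup>2)
      = of_real p - cnj ?c * z - ?c * cnj z + ?c * cnj ?c * of_real q"
      unfolding A_inner_self[symmetric] p_def q_def
      by (simp add: A_inner_simps A_inner_commute[of x y] z_def algebra_simps)
    also have "\<dots> = of_real (p - 2 * t * m + t\<^sup>2 * m * q)"
      using zm by (simp add: algebra_simps power2_eq_square)
        (metis (no_types, lifting) mult.assoc mult.commute)
    finally have "(A_norm A (x - ?c *\<^sub>C y))\<^sup>2 = p - 2 * t * m + t\<^sup>2 * m * q"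
      using of_real_eq_iff by blast
    then show ?thesis
      by (metis zero_le_power2)
  qed
  have "m \<le> p * q"
  proof (cases "q = 0")
    case True
    have "m = 0"
    proof (rule ccontr)
      assume "m \<noteq> 0"
      then show False
        using pos_t[of "(p + 1) / m"] True by (simp add: p_def) (smt (verit) zero_le_power2)
    qed
    then show ?thesis
      by (simp add: p_def q_def)
  next
    case False
    then have "q > 0"
      by (simp add: q_def)
    then show ?thesis
      using pos_t[of "1 / q"] by (simp add: field_simps power2_eq_square)
  qed
  then have "(cmod z)\<^sup>2 \<le> (A_norm A x * A_norm A y)\<^sup>2"
    by (simp add: m_def p_def q_def power_mult_distrib)
  then show ?thesis
    using A_norm_nonneg by (simp add: z_def abs_le_square_iff[symmetric])
qed

text \<open>
  The vector \<open>u = 2 \<langle>x, e\<rangle>\<^sub>A e - x\<close> is the reflection of \<open>x\<close> in the line through \<open>e\<close> and has the same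
  seminorm as \<open>x\<close>. The Cauchy-Schwarz inequality for \<open>u\<close> and \<open>y\<close> is the claim.
\<close>
lemma A_Buzano:
  assumes e: "A_norm A e = 1"
  shows "cmod (A_inner A x e * A_inner A e y)
    \<le> (A_norm A x * A_norm A y + cmod (A_inner A x y)) / 2"
proof -
  define u where "u = (2 * A_inner A x e) *\<^sub>C e - x"
  have "A_inner A e e = 1"
    by (simp add: A_inner_self e)
  then have "of_real ((A_norm A u)\<^sup>2) = (of_real ((A_norm A x)\<^sup>2) :: complex)"
    unfolding A_inner_self[symmetric] u_def
    by (simp add: A_inner_simps A_inner_commute[of x e] algebra_simps)
  then have "(A_norm A u)\<^sup>2 = (A_norm A x)\<^sup>2"
    using of_real_eq_iff by blast
  then have u: "A_norm A u = A_norm A x"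
    using A_norm_nonneg by (simp add: power2_eq_iff_nonneg)
  have "2 * (A_inner A x e * A_inner A e y) = A_inner A u y + A_inner A x y"
    by (simp add: u_def A_inner_simps)
  then have "2 * cmod (A_inner A x e * A_inner A e y) = cmod (A_inner A u y + A_inner A x y)"
    by (metis norm_mult norm_numeral)
  also have "\<dots> \<le> A_norm A x * A_norm A y + cmod (A_inner A x y)"
    using norm_triangle_ineq[of "A_inner A u y" "A_inner A x y"] A_Cauchy_Schwarz[of u y] u
    by simp
  finally show ?thesis
    by simp
qed

lemma A_norm_triangle: "A_norm A (x + y) \<le> A_norm A x + A_norm A y"
proof -
  have "(A_norm A (x + y))\<^sup>2 = Re (A_inner A (x + y) (x + y))"
    by (simp add: A_inner_self)
  also have "\<dots> = Re (A_inner A x x) + Re (A_inner A y y) + 2 * Re (A_inner A x y)"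
    by (simp add: A_inner_simps A_inner_commute[of x y])
  also have "\<dots> = (A_norm A x)\<^sup>2 + (A_norm A y)\<^sup>2 + 2 * Re (A_inner A x y)"
    by (simp add: A_inner_self)
  also have "\<dots> \<le> (A_norm A x)\<^sup>2 + (A_norm A y)\<^sup>2 + 2 * (A_norm A x * A_norm A y)"
    using A_Cauchy_Schwarz[of x y] complex_Re_le_cmod[of "A_inner A x y"] by linarith
  also have "\<dots> = (A_norm A x + A_norm A y)\<^sup>2"
    by (simp add: power2_sum)
  finally show ?thesis
    by (rule power2_le_imp_le) (simp add: A_norm_nonneg)
qed

end

lemma cinner_Cauchy_Schwarz: "cmod (cinner x y) \<le> norm x * norm y"
  using A_Cauchy_Schwarz[OF positive_op_id, of x y] by (simp add: A_inner_id A_norm_id)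

lemma norm_le_if_cinner_le:
  assumes "0 \<le> B" "cmod (cinner v v) \<le> B * norm v"
  shows "norm v \<le> B"
proof (cases "v = 0")
  case False
  then show ?thesis
    using assms(2) by (simp add: cinner_self power2_eq_square norm_mult)
qed (simp add: assms(1))

lemma continuous_on_cinner_left: "continuous_on X (\<lambda>x. cinner x y)"
proof (rule linear_continuous_on)
  show "bounded_linear (\<lambda>x. cinner x y)"
  proof (rule bounded_linear_intro[where K = "norm y"])
    show "cinner (r *\<^sub>R x) y = r *\<^sub>R cinner x y" for r x
      using cinner_scaleC_left[of "of_real r" x y]
      by (simp only: scaleR_scaleC[of r x] scaleR_conv_of_real)
  qed (simp_all add: cinner_add_left cinner_Cauchy_Schwarz)
qed

section \<open>Orthogonal projection and Hilbert space adjoints\<close>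

lemma parallelogram_law:
  fixes x y :: "'a::complex_hilbert_space"
  shows "(norm (x + y))\<^sup>2 + (norm (x - y))\<^sup>2 = 2 * (norm x)\<^sup>2 + 2 * (norm y)\<^sup>2"
proof -
  have "complex_of_real ((norm (x + y))\<^sup>2 + (norm (x - y))\<^sup>2)
    = of_real (2 * (norm x)\<^sup>2 + 2 * (norm y)\<^sup>2)"
    unfolding of_real_add of_real_mult cinner_self[symmetric]
    by (simp add: cinner_add_left cinner_add_right cinner_diff_left cinner_diff_right)
  then show ?thesis
    using of_real_eq_iff by blast
qed

definition closed_csubspace :: "'a::complex_hilbert_space set \<Rightarrow> bool"
  where "closed_csubspace M \<longleftrightarrow> closed M \<and> 0 \<in> M
    \<and> (\<forall>x\<in>M. \<forall>y\<in>M. x + y \<in> M) \<and> (\<forall>c. \<forall>x\<in>M. c *\<^sub>C x \<in> M)"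

text \<open>
  If \<open>c\<close> is chosen so that \<open>z - c u\<close> is orthogonal to \<open>u\<close>, then Pythagoras makes \<open>z - c u\<close> shorter than \<open>z\<close>
  unless \<open>c u = 0\<close>.
\<close>
lemma orthogonal_if_nearest:
  assumes "\<And>c. norm z \<le> norm (z - c *\<^sub>C u)"
  shows "cinner z u = 0"
proof (cases "u = 0")
  case False
  define c where "c = cinner z u / cinner u u"
  have uu: "cinner u u \<noteq> 0"
    using False cinner_self_eq_zero by blast
  define y where "y = z - c *\<^sub>C u"
  have z: "z = y + c *\<^sub>C u"
    by (simp add: y_def)
  have yu: "cinner y u = 0"
    using uu by (simp add: y_def c_def cinner_diff_left cinner_scaleC_left)
  then have "cinner u y = 0"
    by (metis cinner_commute complex_cnj_zero)
  with yu have "cinner z z = cinner y y + cinner (c *\<^sub>C u) (c *\<^sub>C u)"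
    unfolding z by (simp add: cinner_add_left cinner_add_right cinner_scaleC_left cinner_scaleC_right)
  then have "(norm z)\<^sup>2 = (norm y)\<^sup>2 + (norm (c *\<^sub>C u))\<^sup>2"
    unfolding cinner_self of_real_add[symmetric] of_real_eq_iff .
  moreover have "(norm z)\<^sup>2 \<le> (norm y)\<^sup>2"
    unfolding y_def by (intro power_mono assms) simp
  ultimately have "c *\<^sub>C u = 0"
    by simp
  then have "c * cinner u u = 0"
    by (metis cinner_scaleC_left cinner_zero_left)
  then show ?thesis
    using uu by (simp add: c_def)
qed (simp add: cinner_zero_right)

text \<open>
  A sequence in \<open>M\<close> whose distances to \<open>x\<close> approach the infimum is Cauchy by the parallelogram law,
  since the midpoints of its members also lie in \<open>M\<close>. Its limit is a nearest point.
\<close>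
lemma orthogonal_projection:
  assumes "closed_csubspace M"
  obtains m where "m \<in> M" "x - m \<in> ortho_compl M"
proof -
  have M: "closed M" "0 \<in> M" "\<And>x y. x \<in> M \<Longrightarrow> y \<in> M \<Longrightarrow> x + y \<in> M"
    "\<And>c x. x \<in> M \<Longrightarrow> c *\<^sub>C x \<in> M"
    using assms by (auto simp: closed_csubspace_def)
  define d where "d = infdist x M"
  have d_le: "d \<le> norm (x - m)" if "m \<in> M" for m
    using infdist_le[OF that, of x] by (simp add: d_def dist_norm)
  have d0: "0 \<le> d"
    by (simp add: d_def infdist_nonneg)
  have "\<exists>m\<in>M. norm (x - m) < d + inverse (Suc n)" for n
  proof -
    have "d < d + inverse (Suc n)"
      by simp
    then show ?thesis
      using M(2) cInf_less_iff[of "dist x ` M"]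
      by (fastforce simp: d_def infdist_def dist_norm bdd_below_def)
  qed
  then obtain f where fM: "\<And>n. f n \<in> M" and fd: "\<And>n. norm (x - f n) < d + inverse (Suc n)"
    by metis
  define g where "g n = (d + inverse (Suc n))\<^sup>2 - d\<^sup>2" for n
  have lim: "g \<longlonglongrightarrow> (d + 0)\<^sup>2 - d\<^sup>2"
    unfolding g_def by (intro tendsto_intros LIMSEQ_inverse_real_of_nat)
  have mid: "(norm (f i - f j))\<^sup>2 \<le> 2 * g i + 2 * g j" for i j
  proof -
    have "d \<le> norm (x - (1/2) *\<^sub>C (f i + f j))"
      by (intro d_le M fM)
    also have "(1/2) *\<^sub>C (f i + f j) = (1/2) *\<^sub>R (f i + f j)"
      by (simp add: scaleR_scaleC)
    also have "x - (1/2) *\<^sub>R (f i + f j) = (1/2) *\<^sub>R ((x - f i) + (x - f j))"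
      by (simp add: algebra_simps scaleR_2[symmetric])
    finally have "2 * d \<le> norm ((x - f i) + (x - f j))"
      by simp
    then have "(2 * d)\<^sup>2 \<le> (norm ((x - f i) + (x - f j)))\<^sup>2"
      using d0 by (intro power_mono) auto
    moreover have "(norm (x - f n))\<^sup>2 \<le> g n + d\<^sup>2" for n
      using fd[of n] unfolding g_def by (simp add: power_mono)
    moreover have "(x - f i) - (x - f j) = f j - f i"
      by simp
    ultimately show ?thesis
      using parallelogram_law[of "x - f i" "x - f j"]
      by (smt (verit, ccfv_SIG) norm_minus_commute four_x_squared)
  qed
  have "Cauchy f"
  proof (rule CauchyI)
    fix e :: real assume "0 < e"
    then have "\<forall>\<^sub>F n in sequentially. g n < e\<^sup>2 / 4"
      using order_tendstoD(2)[OF lim, of "e\<^sup>2 / 4"] by simp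
    then obtain N where N: "\<And>n. n \<ge> N \<Longrightarrow> g n < e\<^sup>2 / 4"
      by (auto simp: eventually_sequentially)
    have "norm (f i - f j) < e" if "i \<ge> N" "j \<ge> N" for i j
    proof -
      have "(norm (f i - f j))\<^sup>2 < e\<^sup>2"
        using mid[of i j] N[OF that(1)] N[OF that(2)] by linarith
      then show ?thesis
        using \<open>0 < e\<close> by (simp add: power_less_imp_less_base)
    qed
    then show "\<exists>M. \<forall>m\<ge>M. \<forall>n\<ge>M. norm (f m - f n) < e"
      by blast
  qed
  then obtain m where fm: "f \<longlonglongrightarrow> m"
    using Cauchy_convergent_iff convergent_def by blast
  have mM: "m \<in> M"
    using closed_sequentially[OF M(1) fM fm] .
  have upper: "(\<lambda>n. d + inverse (real (Suc n))) \<longlonglongrightarrow> d + 0"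
    by (intro tendsto_intros LIMSEQ_inverse_real_of_nat)
  have "norm (x - m) \<le> d + 0"
    using less_imp_le[OF fd]
    by (intro LIMSEQ_le[OF tendsto_norm[OF tendsto_diff[OF tendsto_const fm]] upper]) blast
  then have near: "norm (x - m) \<le> norm (x - m - c *\<^sub>C u)" if "u \<in> M" for c u
    using d_le[of "m + c *\<^sub>C u"] that M(3,4) mM by (simp add: diff_diff_eq)
  then have "x - m \<in> ortho_compl M"
    unfolding ortho_compl_def using orthogonal_if_nearest by blast
  with mM show thesis
    by (rule that)
qed

lemma closed_csubspace_kernel:
  assumes "continuous_on UNIV f" "\<And>x y. f (x + y) = f x + f y" "\<And>c x. f x = 0 \<Longrightarrow> f (c *\<^sub>C x) = 0"
    "f 0 = (0 :: 'b::real_normed_vector)"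
  shows "closed_csubspace {x. f x = 0}"
  unfolding closed_csubspace_def
  using assms continuous_closed_preimage_constant[of UNIV f 0] by auto

text \<open>
  The orthogonal complement of the kernel of a nonzero functional contains some \<open>z\<close> outside the
  kernel, and \<open>x - (f x / f z) z\<close> is in the kernel for every \<open>x\<close>.
\<close>
lemma Riesz_representation:
  fixes f :: "'a::complex_hilbert_space \<Rightarrow> complex"
  assumes cont: "continuous_on UNIV f" and add: "\<And>x y. f (x + y) = f x + f y"
    and scale: "\<And>c x. f (c *\<^sub>C x) = c * f x"
  obtains v where "\<And>x. f x = cinner x v"
proof (cases "\<forall>x. f x = 0")
  case True
  then show thesis
    using that[of 0] by (simp add: cinner_zero_right)
next
  case False
  then obtain x0 where x0: "f x0 \<noteq> 0"
    by blast
  have f0: "f 0 = 0"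
    using add[of 0 0] by simp
  have diff: "f (x - y) = f x - f y" for x y
    using add[of "x - y" y] by simp
  have "closed_csubspace {x. f x = 0}"
    by (rule closed_csubspace_kernel) (simp_all add: cont add scale f0)
  then obtain m where m: "f m = 0" "x0 - m \<in> ortho_compl {x. f x = 0}"
    using orthogonal_projection by blast
  define z where "z = x0 - m"
  have fz: "f z \<noteq> 0"
    by (simp add: z_def diff m(1) x0)
  then have zz: "cinner z z \<noteq> 0"
    using cinner_self_eq_zero f0 by metis
  have "f x = cinner x (cnj (f z / cinner z z) *\<^sub>C z)" for x
  proof -
    have "f (x - (f x / f z) *\<^sub>C z) = 0"
      using fz by (simp add: diff scale)
    then have "cinner z (x - (f x / f z) *\<^sub>C z) = 0"
      using m(2) by (simp add: ortho_compl_def z_def)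
    then have "cinner (x - (f x / f z) *\<^sub>C z) z = 0"
      by (metis cinner_commute complex_cnj_zero)
    then show ?thesis
      using fz zz by (simp add: cinner_diff_left cinner_scaleC_left cinner_scaleC_right field_simps)
  qed
  then show thesis
    by (rule that)
qed

lemma cinner_right_cancel:
  assumes "\<And>x. cinner x u = cinner x v"
  shows "u = v"
proof -
  have "cinner (u - v) (u - v) = 0"
    by (simp add: cinner_diff_right assms)
  then show ?thesis
    by (simp add: cinner_self_eq_zero)
qed

lemma bounded_clinear_norm_le:
  assumes "bounded_clinear T"
  obtains K where "0 < K" "\<And>x. norm (T x) \<le> K * norm x"
  using assms bounded_linear.pos_bounded[of T] unfolding bounded_clinear_def
  by (metis mult.commute)

text \<open>
  The definite description in \<open>hadjoint\<close> is met: the Riesz representation gives an operator pointwise,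
  and its linearity and boundedness follow from the adjoint relation.
\<close>
lemma cinner_hadjoint:
  assumes T: "bounded_clinear T"
  shows "cinner (T x) y = cinner x (hadjoint T y)"
proof -
  obtain K where K: "0 < K" "\<And>x. norm (T x) \<le> K * norm x"
    using bounded_clinear_norm_le[OF T] by blast
  have "\<exists>v. \<forall>x. cinner (T x) y = cinner x v" for y
  proof (rule Riesz_representation[of "\<lambda>x. cinner (T x) y"])
    show "continuous_on UNIV (\<lambda>x. cinner (T x) y)"
      using continuous_on_compose2[OF continuous_on_cinner_left bounded_clinearD(5)[OF T]] by blast
  qed (auto simp: bounded_clinearD[OF T] cinner_add_left cinner_scaleC_left)
  then obtain S where S: "\<And>x y. cinner (T x) y = cinner x (S y)"
    by metis
  have "bounded_clinear S"
    unfolding bounded_clinear_def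
  proof (intro conjI allI bounded_linear_intro[where K = K])
    fix x y :: 'a and r :: real and c :: complex
    show "S (x + y) = S x + S y"
      by (rule cinner_right_cancel) (simp add: S[symmetric] cinner_add_right)
    show sc: "S (c *\<^sub>C x) = c *\<^sub>C S x" for c x
      by (rule cinner_right_cancel) (simp add: S[symmetric] cinner_scaleC_right)
    show "S (r *\<^sub>R x) = r *\<^sub>R S x"
      by (simp add: scaleR_scaleC sc)
    have "cmod (cinner (S x) (S x)) \<le> norm (T (S x)) * norm x"
      unfolding S[symmetric] by (rule cinner_Cauchy_Schwarz)
    also have "\<dots> \<le> K * norm (S x) * norm x"
      by (intro mult_right_mono K) simp
    finally show "norm (S x) \<le> norm x * K"
      using norm_le_if_cinner_le[of "norm x * K" "S x"] K(1) by (simp add: mult_ac)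
  qed
  moreover have "R = S" if "\<forall>x y. cinner (T x) y = cinner x (R y)" for R
    using that S cinner_right_cancel by (metis ext)
  ultimately have "hadjoint T = S"
    unfolding hadjoint_def by (intro the_equality) (use S in auto)
  then show ?thesis
    using S by simp
qed

text \<open>
  The solution is \<open>u - m\<close> where \<open>A u = y\<close> and \<open>m\<close> is the projection of \<open>u\<close> onto the kernel. Any other
  solution has the same image, so the difference lies in the kernel and in its orthogonal
  complement.
\<close>
lemma moore_penrose_right_inverse:
  assumes A: "bounded_clinear A" and y: "y \<in> range A"
  shows "A (moore_penrose A y) = y"
proof -
  let ?K = "{u. A u = 0}"
  let ?P = "\<lambda>x. x \<in> ortho_compl ?K \<and> y - A x \<in> ortho_compl (range A)"
  note lin = bounded_clinearD[OF A]
  have "closed_csubspace ?K"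
    by (rule closed_csubspace_kernel) (simp_all add: lin scaleC_zero_right)
  obtain u where u: "y = A u"
    using y by blast
  obtain m where m: "m \<in> ?K" "u - m \<in> ortho_compl ?K"
    using orthogonal_projection[OF \<open>closed_csubspace ?K\<close>] by blast
  have sol: "?P x \<Longrightarrow> A x = y" for x
  proof -
    assume "?P x"
    moreover have "y - A x \<in> range A"
      by (simp add: u lin(3)[symmetric])
    ultimately have "cinner (y - A x) (y - A x) = 0"
      unfolding ortho_compl_def by blast
    then show "A x = y"
      by (simp add: cinner_self_eq_zero)
  qed
  have "?P (u - m)"
    using m u by (simp add: lin ortho_compl_def cinner_zero_left)
  moreover have "x = x'" if "?P x" "?P x'" for x x'
  proof -
    have "x - x' \<in> ?K"
      using sol[OF that(1)] sol[OF that(2)] by (simp add: lin(3))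
    then have "cinner (x - x') (x - x') = 0"
      using that unfolding ortho_compl_def by (simp add: cinner_diff_left)
    then show ?thesis
      by (simp add: cinner_self_eq_zero)
  qed
  ultimately have "?P (moore_penrose A y)"
    unfolding moore_penrose_def by (intro theI[of ?P "u - m"]) blast+
  then show ?thesis
    by (rule sol)
qed

lemma A_inner_A_adjoint:
  assumes pos: "positive_op A" and T: "T \<in> A_adjointable A"
  shows "A_inner A (T x) y = A_inner A x (A_adjoint A T y)"
proof -
  have Tl: "bounded_clinear T" and ran: "hadjoint T (A y) \<in> range A"
    using T by (auto simp: A_adjointable_def)
  have "A_inner A (T x) y = cinner x (hadjoint T (A y))"
    by (simp add: A_inner_def A_selfadjoint[OF pos] cinner_hadjoint[OF Tl])
  also have "\<dots> = cinner x (A (A_adjoint A T y))"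
    by (simp add: A_adjoint_def moore_penrose_right_inverse[OF A_clinear[OF pos] ran])
  finally show ?thesis
    by (simp add: A_inner_def A_selfadjoint[OF pos])
qed

section \<open>Boundedness for the seminorm of a positive operator\<close>

text \<open>
  The uniform boundedness principle for the functionals \<open>\<langle>_, v\<rangle>\<close>. By Baire's theorem one of the
  closed sets on which all of them are bounded by \<open>n\<close> contains a ball, and moving from its centre
  towards \<open>v\<close> bounds the norm of \<open>v\<close>.
\<close>
lemma weakly_bounded_imp_bounded:
  fixes V :: "'a::complex_hilbert_space set"
  assumes weak: "\<And>y. \<exists>B. \<forall>v\<in>V. cmod (cinner y v) \<le> B"
  obtains M where "\<And>v. v \<in> V \<Longrightarrow> norm v \<le> M"
proof -
  define F where "F n = {y. \<forall>v\<in>V. cmod (cinner y v) \<le> real n}" for n :: nat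
  have "F n = (\<Inter>v\<in>V. {y. cmod (cinner y v) \<le> real n})" for n
    by (auto simp: F_def)
  then have closed: "closed (F n)" for n
    by (auto intro!: closed_INT closed_Collect_le continuous_intros continuous_on_cinner_left)
  have "y \<in> (\<Union>n. F n)" for y
  proof -
    obtain B where B: "\<forall>v\<in>V. cmod (cinner y v) \<le> B"
      using weak by blast
    obtain n where "B \<le> real n"
      using real_arch_simple by blast
    with B have "y \<in> F n"
      unfolding F_def by force
    then show ?thesis
      by blast
  qed
  then have UN: "\<Union>(range F) = UNIV"
    by blast
  have "\<exists>n. interior (F n) \<noteq> {}"
  proof (rule ccontr)
    assume "\<not> ?thesis"
    then have "euclidean interior_of \<Union>(range F) = {}"
      using closed
      by (intro Baire_category_alt) (auto simp: completely_metrizable_space_euclidean)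
    then show False
      by (simp add: UN)
  qed
  then obtain n y0 r where r: "0 < r" "cball y0 r \<subseteq> F n"
    by (auto simp: mem_interior_cball)
  have "norm v \<le> 2 * real n / r" if v: "v \<in> V" for v
  proof (cases "v = 0")
    case True
    then show ?thesis
      using r(1) by simp
  next
    case False
    let ?u = "(r / norm v) *\<^sub>R v"
    have "y0 \<in> F n" "y0 + ?u \<in> F n"
      using r False by (auto simp: subset_iff dist_norm)
    then have b: "cmod (cinner y0 v) \<le> n" "cmod (cinner (y0 + ?u) v) \<le> n"
      using v by (auto simp: F_def)
    have "cinner ?u v = of_real (r * norm v)"
      using False
      by (simp add: scaleR_scaleC[of _ v] cinner_scaleC_left cinner_self power2_eq_square)
    then have "cinner (y0 + ?u) v - cinner y0 v = of_real (r * norm v)"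
      by (simp add: cinner_add_left)
    then have "r * norm v = cmod (cinner (y0 + ?u) v - cinner y0 v)"
      using r(1) by (simp add: norm_mult)
    also have "\<dots> \<le> 2 * real n"
      using norm_triangle_ineq4[of "cinner (y0 + ?u) v" "cinner y0 v"] b by linarith
    finally show ?thesis
      using r(1) by (simp add: field_simps)
  qed
  then show thesis
    by (rule that)
qed

text \<open>
  Symmetry makes \<open>a\<^sub>k = \<parallel>R\<^sup>k x\<parallel>\<^sub>A\<close> log-convex, so it grows at least geometrically with ratio
  \<open>r = a\<^sub>1 / a\<^sub>0\<close>. On the other hand \<open>a\<^sub>k\<^sup>2 = \<langle>R\<^sup>2\<^sup>k x, x\<rangle>\<^sub>A \<le> \<parallel>A R\<^sup>2\<^sup>k x\<parallel> \<parallel>x\<parallel>\<close> grows at most like \<open>C\<^sup>2\<^sup>k\<close>. Hence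
  \<open>r \<le> C\<close>. If \<open>a\<^sub>0 = 0\<close>, then log-convexity gives \<open>a\<^sub>1 = 0\<close>.
\<close>
lemma A_norm_bound_if_symmetric:
  assumes pos: "positive_op A"
    and sym: "\<And>x y. A_inner A (R x) y = A_inner A x (R y)"
    and C: "0 < C" and bound: "\<And>z. norm (A (R z)) \<le> C * norm (A z)"
  shows "A_norm A (R x) \<le> C * A_norm A x"
proof (rule ccontr)
  define a where "a k = A_norm A ((R ^^ k) x)" for k
  define D where "D = norm (A x) * norm x"
  assume "\<not> ?thesis"
  then have less: "C * a 0 < a 1"
    by (simp add: a_def)
  have a_nonneg: "0 \<le> a k" for k
    by (simp add: a_def A_norm_nonneg[OF pos])
  have log_convex: "(a (Suc k))\<^sup>2 \<le> a (Suc (Suc k)) * a k" for k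
  proof -
    let ?y = "(R ^^ k) x"
    have "(a (Suc k))\<^sup>2 = cmod (A_inner A (R (R ?y)) ?y)"
      unfolding sym[of "R ?y"] by (simp add: a_def cmod_A_inner_self[OF pos])
    also have "\<dots> \<le> a (Suc (Suc k)) * a k"
      using A_Cauchy_Schwarz[OF pos, of "R (R ?y)" ?y] by (simp add: a_def)
    finally show ?thesis .
  qed
  have a0: "0 < a 0"
  proof (rule ccontr)
    assume "\<not> 0 < a 0"
    then have "a 0 = 0"
      using a_nonneg[of 0] by simp
    then show False
      using log_convex[of 0] less by simp
  qed
  define r where "r = a 1 / a 0"
  have r: "C < r"
    using less a0 by (simp add: r_def field_simps)
  have ratio: "r * a k \<le> a (Suc k)" for k
  proof (induction k)
    case 0
    then show ?case
      using a0 by (simp add: r_def)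
  next
    case (Suc k)
    show ?case
    proof (cases "a (Suc k) = 0")
      case True
      then show ?thesis
        by (simp add: a_nonneg)
    next
      case False
      then have pos_Suc: "0 < a (Suc k)"
        using a_nonneg[of "Suc k"] by simp
      then have "0 < a (Suc (Suc k)) * a k"
        using log_convex[of k] by (smt (verit) zero_less_power)
      then have pos_k: "0 < a k"
        using a_nonneg[of k] by (cases "a k = 0") auto
      have "(r * a (Suc k)) * a k = (r * a k) * a (Suc k)"
        by simp
      also have "\<dots> \<le> a (Suc k) * a (Suc k)"
        by (intro mult_right_mono Suc a_nonneg)
      also have "\<dots> \<le> a (Suc (Suc k)) * a k"
        using log_convex[of k] by (simp add: power2_eq_square)
      finally show ?thesis
        using pos_k by simp
    qed
  qed
  have lower: "r ^ k * a 0 \<le> a k" for k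
  proof (induction k)
    case (Suc k)
    then have "r * (r ^ k * a 0) \<le> r * a k"
      using r C by (intro mult_left_mono) auto
    then show ?case
      using ratio[of k] by (simp add: mult.assoc)
  qed simp
  have sym_pow: "A_inner A ((R ^^ k) y) z = A_inner A y ((R ^^ k) z)" for k y z
    by (induction k arbitrary: z) (simp_all add: sym funpow_swap1[symmetric])
  have growth: "norm (A ((R ^^ k) x)) \<le> C ^ k * norm (A x)" for k
  proof (induction k)
    case (Suc k)
    have "norm (A ((R ^^ Suc k) x)) \<le> C * norm (A ((R ^^ k) x))"
      using bound by simp
    also have "\<dots> \<le> C * (C ^ k * norm (A x))"
      using Suc C by (intro mult_left_mono) auto
    finally show ?case
      by (simp add: mult.assoc)
  qed simp
  have upper: "(a k)\<^sup>2 \<le> (C ^ k)\<^sup>2 * D" for k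
  proof -
    have "(a k)\<^sup>2 = cmod (A_inner A ((R ^^ k) ((R ^^ k) x)) x)"
      unfolding sym_pow[of k "(R ^^ k) x"] by (simp add: a_def cmod_A_inner_self[OF pos])
    also have "\<dots> = cmod (cinner (A ((R ^^ (k + k)) x)) x)"
      by (simp add: funpow_add A_inner_def)
    also have "\<dots> \<le> norm (A ((R ^^ (k + k)) x)) * norm x"
      by (rule cinner_Cauchy_Schwarz)
    also have "\<dots> \<le> C ^ (k + k) * norm (A x) * norm x"
      by (intro mult_right_mono growth) simp
    finally show ?thesis
      by (simp add: D_def power_add power2_eq_square mult.assoc)
  qed
  have "((r / C)\<^sup>2) ^ k \<le> D / (a 0)\<^sup>2" for k
  proof -
    have "(r ^ k * a 0)\<^sup>2 \<le> (C ^ k)\<^sup>2 * D"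
      using power_mono[OF lower[of k], of 2] upper[of k] r C a0 by simp
    then have "(r ^ k)\<^sup>2 / (C ^ k)\<^sup>2 \<le> D / (a 0)\<^sup>2"
      using C a0 by (simp add: field_simps power_mult_distrib)
    moreover have "((r / C)\<^sup>2) ^ k = (r ^ k)\<^sup>2 / (C ^ k)\<^sup>2"
      by (simp add: power_divide power_mult[symmetric] mult.commute)
    ultimately show ?thesis
      by simp
  qed
  moreover have "1 < (r / C)\<^sup>2"
    using r C by (simp add: one_less_power)
  ultimately show False
    using real_arch_pow[of "(r / C)\<^sup>2" "D / (a 0)\<^sup>2"] by (meson not_less)
qed

text \<open>
  The functionals \<open>\<langle>_, A T z\<rangle>\<close> with \<open>\<parallel>A z\<parallel> \<le> 1\<close> are bounded at each \<open>y\<close> by \<open>\<parallel>S y\<parallel>\<close>, because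
  \<open>\<langle>A T z, y\<rangle> = \<langle>A z, S y\<rangle>\<close>. Uniform boundedness gives \<open>\<parallel>A T z\<parallel> \<le> M \<parallel>A z\<parallel>\<close>, and ordinary boundedness
  of \<open>T\<close> gives \<open>\<parallel>A S z\<parallel> \<le> K \<parallel>A z\<parallel>\<close>. So \<open>R = S T\<close> meets the hypotheses of the preceding lemma, and
  \<open>\<parallel>T x\<parallel>\<^sub>A\<^sup>2 = \<langle>x, R x\<rangle>\<^sub>A\<close> passes the bound on to \<open>T\<close> and then to \<open>S\<close>.
\<close>
lemma A_adjoint_pair_bounded:
  assumes pos: "positive_op A" and T: "bounded_clinear T"
    and adj: "\<And>x y. A_inner A (T x) y = A_inner A x (S y)"
  obtains c where "0 \<le> c" "\<And>x. A_norm A (T x) \<le> c * A_norm A x"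
    "\<And>x. A_norm A (S x) \<le> c * A_norm A x"
proof -
  note Alin = A_clinear[OF pos]
  have adj': "A_inner A (S x) y = A_inner A x (T y)" for x y
    by (metis A_inner_commute[OF pos] adj)
  obtain K where K: "0 < K" "\<And>x. norm (T x) \<le> K * norm x"
    using bounded_clinear_norm_le[OF T] by blast
  define V where "V = {A (T z) |z. norm (A z) \<le> 1}"
  have weak: "cmod (cinner y (A (T z))) \<le> norm (A z) * norm (S y)" for y z
  proof -
    have "cinner y (A (T z)) = cnj (A_inner A z (S y))"
      by (metis A_inner_def adj cinner_commute)
    then show ?thesis
      using cinner_Cauchy_Schwarz[of "A z" "S y"] by (simp add: A_inner_def)
  qed
  have "\<exists>B. \<forall>v\<in>V. cmod (cinner y v) \<le> B" for y
  proof (intro exI ballI)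
    fix v assume "v \<in> V"
    then obtain z where z: "v = A (T z)" "norm (A z) \<le> 1"
      by (auto simp: V_def)
    have "norm (A z) * norm (S y) \<le> 1 * norm (S y)"
      by (intro mult_right_mono z) simp
    then show "cmod (cinner y v) \<le> norm (S y)"
      using weak[of y z] z(1) by simp
  qed
  then obtain M where M: "\<And>v. v \<in> V \<Longrightarrow> norm v \<le> M"
    using weakly_bounded_imp_bounded by blast
  have M_nonneg: "0 \<le> M"
  proof (rule order_trans[OF norm_ge_zero M])
    show "A (T 0) \<in> V"
      unfolding V_def by (intro CollectI exI[of _ 0]) (simp add: bounded_clinearD(4)[OF Alin])
  qed
  have AT: "norm (A (T z)) \<le> M * norm (A z)" for z
  proof (cases "A z = 0")
    case True
    then have "cinner (A (T z)) (A (T z)) = 0"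
      using weak[of "A (T z)" z] by simp
    then show ?thesis
      by (simp add: cinner_self_eq_zero True)
  next
    case False
    let ?u = "(1 / norm (A z)) *\<^sub>R z"
    have "norm (A ?u) \<le> 1"
      using False by (simp add: bounded_clinearD(6)[OF Alin])
    then have "norm (A (T ?u)) \<le> M"
      by (intro M) (auto simp: V_def)
    then have "norm (A (T z)) / norm (A z) \<le> M"
      by (simp add: bounded_clinearD(6)[OF Alin] bounded_clinearD(6)[OF T])
    then show ?thesis
      using False by (simp add: field_simps)
  qed
  have AS: "norm (A (S z)) \<le> K * norm (A z)" for z
  proof (rule norm_le_if_cinner_le)
    let ?v = "A (S z)"
    have "cinner ?v ?v = cinner (A z) (T ?v)"
      using adj'[of z ?v] by (simp add: A_inner_def)
    then have "cmod (cinner ?v ?v) \<le> norm (A z) * norm (T ?v)"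
      by (simp add: cinner_Cauchy_Schwarz)
    also have "\<dots> \<le> norm (A z) * (K * norm ?v)"
      by (intro mult_left_mono K) simp
    finally show "cmod (cinner ?v ?v) \<le> K * norm (A z) * norm ?v"
      by (simp add: mult_ac)
  qed (use K in simp)
  \<comment> \<open>The summand \<open>1\<close> makes the constant positive even if \<open>M = 0\<close>.\<close>
  define C where "C = K * (M + 1)"
  have C: "0 < C"
    using K M_nonneg by (simp add: C_def)
  have ST: "A_norm A (S (T x)) \<le> C * A_norm A x" for x
  proof (rule A_norm_bound_if_symmetric[OF pos, where R = "\<lambda>x. S (T x)"])
    show "norm (A (S (T z))) \<le> C * norm (A z)" for z
    proof -
      have "norm (A (S (T z))) \<le> K * (M * norm (A z))"
        using K(1) by (intro order_trans[OF AS[of "T z"]] mult_left_mono AT) simp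
      also have "\<dots> \<le> C * norm (A z)"
        using K(1) by (simp add: C_def algebra_simps)
      finally show ?thesis .
    qed
  qed (simp_all add: adj adj' C)
  define c where "c = sqrt C"
  have c: "0 \<le> c" "c\<^sup>2 = C"
    using C by (simp_all add: c_def)
  have Tc: "A_norm A (T x) \<le> c * A_norm A x" for x
  proof (rule power2_le_imp_le)
    have "(A_norm A (T x))\<^sup>2 = cmod (A_inner A x (S (T x)))"
      unfolding adj[symmetric] by (simp add: cmod_A_inner_self[OF pos])
    also have "\<dots> \<le> A_norm A x * A_norm A (S (T x))"
      by (rule A_Cauchy_Schwarz[OF pos])
    also have "\<dots> \<le> A_norm A x * (C * A_norm A x)"
      by (intro mult_left_mono ST A_norm_nonneg[OF pos])
    also have "\<dots> = (c * A_norm A x)\<^sup>2"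
      using c(2) by (simp add: power_mult_distrib power2_eq_square)
    finally show "(A_norm A (T x))\<^sup>2 \<le> (c * A_norm A x)\<^sup>2" .
  qed (simp add: c A_norm_nonneg[OF pos])
  have Sc: "A_norm A (S x) \<le> c * A_norm A x" for x
  proof -
    have "(A_norm A (S x))\<^sup>2 = cmod (A_inner A (T (S x)) x)"
      unfolding adj by (simp add: cmod_A_inner_self[OF pos])
    also have "\<dots> \<le> A_norm A (T (S x)) * A_norm A x"
      by (rule A_Cauchy_Schwarz[OF pos])
    also have "\<dots> \<le> c * A_norm A (S x) * A_norm A x"
      by (intro mult_right_mono Tc A_norm_nonneg[OF pos])
    finally have "A_norm A (S x) * A_norm A (S x) \<le> (c * A_norm A x) * A_norm A (S x)"
      by (simp add: power2_eq_square mult_ac)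
    moreover have "0 \<le> c * A_norm A x"
      by (simp add: c A_norm_nonneg[OF pos])
    ultimately show ?thesis
      using A_norm_nonneg[OF pos, of "S x"]
      by (metis antisym_conv2 mult_le_cancel_right not_le)
  qed
  show thesis
    using c(1) Tc Sc by (rule that)
qed

section \<open>Numerical radius inequalities\<close>

text \<open>
  A real supremum is meaningful only for a set that is bounded above; the bound \<open>B\<close> provides this.
\<close>
lemma A_opnorm_bounds:
  assumes "\<And>x. A_norm A x = 1 \<Longrightarrow> A_norm A (P x) \<le> B"
  shows "A_norm A x = 1 \<Longrightarrow> A_norm A (P x) \<le> A_opnorm A P"
    and "0 \<le> A_opnorm A P"
proof -
  have "bdd_above (insert 0 {A_norm A (P x) |x. A_norm A x = 1})"
    unfolding bdd_above_insert using assms by (auto intro!: bdd_aboveI[where M = B])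
  then show "A_norm A x = 1 \<Longrightarrow> A_norm A (P x) \<le> A_opnorm A P"
    and "0 \<le> A_opnorm A P"
    unfolding A_opnorm_def by (auto intro: cSup_upper)
qed

lemma A_numrad_bounds:
  assumes "\<And>x. A_norm A x = 1 \<Longrightarrow> cmod (A_inner A (P x) x) \<le> B"
  shows "A_norm A x = 1 \<Longrightarrow> cmod (A_inner A (P x) x) \<le> A_numrad A P"
    and "0 \<le> A_numrad A P"
proof -
  have "bdd_above (insert 0 {cmod (A_inner A (P x) x) |x. A_norm A x = 1})"
    unfolding bdd_above_insert using assms by (auto intro!: bdd_aboveI[where M = B])
  then show "A_norm A x = 1 \<Longrightarrow> cmod (A_inner A (P x) x) \<le> A_numrad A P"
    and "0 \<le> A_numrad A P"
    unfolding A_numrad_def by (auto intro: cSup_upper)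
qed

lemma A_numrad_least:
  assumes "0 \<le> B" and "\<And>x. A_norm A x = 1 \<Longrightarrow> cmod (A_inner A (P x) x) \<le> B"
  shows "A_numrad A P \<le> B"
  unfolding A_numrad_def using assms by (intro cSup_least) auto

text \<open>
  The right-hand side exceeds the left by \<open>(a - b) ((3 - \<gamma>\<^sub>2) a + b)\<close>, since \<open>\<gamma>\<^sub>1 + \<gamma>\<^sub>2 = 4\<close>. Moreover
  \<open>\<gamma>\<^sub>2 \<le> (3 + 2 \<beta>) / (1 + \<beta>) \<le> 3\<close>.
\<close>
lemma interpolated_square_bound:
  fixes a b \<alpha> \<beta> :: real
  assumes "0 \<le> b" "b \<le> a" "0 \<le> \<alpha>" "\<alpha> \<le> 1" "0 \<le> \<beta>"
    and \<gamma>\<^sub>1: "\<gamma>\<^sub>1 = ((2 * \<beta> + 1) * (1 + \<alpha>\<^sup>2) + 2 * \<alpha>) / (1 + \<beta>)"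
    and \<gamma>\<^sub>2: "\<gamma>\<^sub>2 = (1 - \<alpha>) * (2 + (1 + \<alpha>) * (1 + 2 * \<beta>)) / (1 + \<beta>)"
  shows "(a + b)\<^sup>2 \<le> \<gamma>\<^sub>1 * a\<^sup>2 + \<gamma>\<^sub>2 * a * b"
proof -
  have "1 + \<beta> \<noteq> 0"
    using assms(5) by simp
  then have \<gamma>\<^sub>1': "\<gamma>\<^sub>1 = 4 - \<gamma>\<^sub>2"
    unfolding \<gamma>\<^sub>1 \<gamma>\<^sub>2 by (simp add: field_simps power2_eq_square)
  have "(1 - \<alpha>) * (2 + (1 + \<alpha>) * (1 + 2 * \<beta>)) = 2 * (1 - \<alpha>) + (1 - \<alpha>\<^sup>2) * (1 + 2 * \<beta>)"
    by (simp add: algebra_simps power2_eq_square)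
  also have "\<dots> \<le> 2 * 1 + 1 * (1 + 2 * \<beta>)"
    using assms(3-5) by (intro add_mono mult_left_mono mult_right_mono) auto
  also have "\<dots> \<le> 3 * (1 + \<beta>)"
    using assms(5) by simp
  finally have "\<gamma>\<^sub>2 \<le> 3"
    using assms(5) unfolding \<gamma>\<^sub>2 by (simp add: divide_le_eq)
  then have "0 \<le> (3 - \<gamma>\<^sub>2) * (a * (a - b)) + b * (a - b)"
    using assms(1,2) by (intro add_nonneg_nonneg mult_nonneg_nonneg) auto
  then show ?thesis
    unfolding \<gamma>\<^sub>1' by (simp add: algebra_simps power2_eq_square)
qed

text \<open>
  The first bound is Buzano's inequality at \<open>T x\<close>, \<open>x\<close> and \<open>S x\<close>; the last is the Cauchy-Schwarz
  inequality for \<open>\<langle>T\<^sup>2 x, x\<rangle>\<^sub>A = \<langle>T x, S x\<rangle>\<^sub>A\<close>. Both use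
  \<open>\<parallel>T x\<parallel>\<^sub>A \<parallel>S x\<parallel>\<^sub>A \<le> (\<parallel>T x\<parallel>\<^sub>A\<^sup>2 + \<parallel>S x\<parallel>\<^sub>A\<^sup>2) / 2 = \<langle>(S T + T S) x, x\<rangle>\<^sub>A / 2 \<le> N / 2\<close>.
\<close>
lemma A_numrad_square_bounds:
  fixes A T S :: "'a::complex_hilbert_space \<Rightarrow> 'a"
  assumes pos: "positive_op A" and T: "bounded_clinear T"
    and adj: "\<And>x y. A_inner A (T x) y = A_inner A x (S y)"
  defines "N \<equiv> A_opnorm A (\<lambda>x. S (T x) + T (S x))" and "W \<equiv> A_numrad A (T ^^ 2)"
  shows "(A_numrad A T)\<^sup>2 \<le> N / 4 + W / 2" and "0 \<le> W" and "W \<le> N / 2"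
proof -
  note CS = A_Cauchy_Schwarz[OF pos]
  have adj': "A_inner A (S x) y = A_inner A x (T y)" for x y
    by (metis A_inner_commute[OF pos] adj)
  obtain c where c: "0 \<le> c" "\<And>x. A_norm A (T x) \<le> c * A_norm A x"
    "\<And>x. A_norm A (S x) \<le> c * A_norm A x"
    using A_adjoint_pair_bounded[OF pos T adj] by blast
  have N_bdd: "A_norm A (S (T x) + T (S x)) \<le> 2 * c\<^sup>2" if x: "A_norm A x = 1" for x
  proof -
    have "A_norm A (S (T x)) \<le> c * c" "A_norm A (T (S x)) \<le> c * c"
      using order_trans[OF c(3)[of "T x"] mult_left_mono[OF c(2)[of x] c(1)]]
        order_trans[OF c(2)[of "S x"] mult_left_mono[OF c(3)[of x] c(1)]] x by simp_all
    then show ?thesis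
      using A_norm_triangle[OF pos, of "S (T x)" "T (S x)"] by (simp add: power2_eq_square)
  qed
  have N0: "0 \<le> N"
    unfolding N_def by (rule A_opnorm_bounds(2)[where B = "2 * c\<^sup>2"]) (rule N_bdd)
  have N: "(A_norm A (T x))\<^sup>2 + (A_norm A (S x))\<^sup>2 \<le> N" if x: "A_norm A x = 1" for x
  proof -
    have "complex_of_real ((A_norm A (T x))\<^sup>2 + (A_norm A (S x))\<^sup>2)
      = A_inner A (S (T x) + T (S x)) x"
      unfolding of_real_add A_inner_self[OF pos, symmetric]
      by (simp add: A_inner_simps(1)[OF pos] adj adj')
    then have "(A_norm A (T x))\<^sup>2 + (A_norm A (S x))\<^sup>2 = cmod (A_inner A (S (T x) + T (S x)) x)"
      by (metis abs_of_nonneg add_nonneg_nonneg norm_of_real zero_le_power2)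
    also have "\<dots> \<le> A_norm A (S (T x) + T (S x))"
      using CS[of "S (T x) + T (S x)" x] x by simp
    also have "\<dots> \<le> N"
      unfolding N_def
      by (rule A_opnorm_bounds(1)[where B = "2 * c\<^sup>2" and P = "\<lambda>x. S (T x) + T (S x)"])
        (use N_bdd x in auto)
    finally show ?thesis .
  qed
  have prod: "A_norm A (T x) * A_norm A (S x) \<le> N / 2" if "A_norm A x = 1" for x
    using N[OF that] sum_squares_bound[of "A_norm A (T x)" "A_norm A (S x)"] by linarith
  have T2: "A_inner A ((T ^^ 2) x) x = A_inner A (T x) (S x)" for x
    by (simp add: numeral_2_eq_2 adj)
  have T2_le: "cmod (A_inner A ((T ^^ 2) x) x) \<le> N / 2" if "A_norm A x = 1" for x
    unfolding T2 using CS[of "T x" "S x"] prod[OF that] by linarith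
  have W: "cmod (A_inner A ((T ^^ 2) x) x) \<le> W" if "A_norm A x = 1" for x
    unfolding W_def by (rule A_numrad_bounds(1)[where B = "N / 2"]) (use T2_le that in auto)
  show W0: "0 \<le> W"
    unfolding W_def by (rule A_numrad_bounds(2)[where B = "N / 2"]) (rule T2_le)
  show "W \<le> N / 2"
    unfolding W_def using T2_le N0 by (intro A_numrad_least) auto
  have T1_sq: "(cmod (A_inner A (T x) x))\<^sup>2 \<le> N / 4 + W / 2" if x: "A_norm A x = 1" for x
  proof -
    have "(cmod (A_inner A (T x) x))\<^sup>2 = cmod (A_inner A (T x) x * A_inner A x (S x))"
      by (simp add: norm_mult power2_eq_square adj)
    also have "\<dots> \<le> (A_norm A (T x) * A_norm A (S x) + cmod (A_inner A (T x) (S x))) / 2"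
      by (rule A_Buzano[OF pos x])
    also have "\<dots> \<le> N / 4 + W / 2"
      using prod[OF x] W[OF x] unfolding T2 by simp
    finally show ?thesis .
  qed
  then have T1: "cmod (A_inner A (T x) x) \<le> sqrt (N / 4 + W / 2)" if "A_norm A x = 1" for x
    using that by (intro real_le_rsqrt) auto
  have "A_numrad A T \<le> sqrt (N / 4 + W / 2)"
    using T1 N0 W0 by (intro A_numrad_least) auto
  moreover have "0 \<le> A_numrad A T"
    by (rule A_numrad_bounds(2)[where B = "sqrt (N / 4 + W / 2)"]) (rule T1)
  ultimately have "(A_numrad A T)\<^sup>2 \<le> (sqrt (N / 4 + W / 2))\<^sup>2"
    by (rule power_mono)
  then show "(A_numrad A T)\<^sup>2 \<le> N / 4 + W / 2"
    using N0 W0 by simp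
qed

theorem theorem3p1:
  fixes A T :: "'a::complex_hilbert_space \<Rightarrow> 'a"
    and \<alpha> \<beta> \<gamma>\<^sub>1 \<gamma>\<^sub>2 :: real
  assumes "(UNIV :: 'a set) \<noteq> {0}"
    and "positive_op A"
    and "T \<in> A_adjointable A"
    and "\<alpha> \<in> {0..1}" and "\<beta> \<ge> 0"
    and "\<gamma>\<^sub>1 = ((2 * \<beta> + 1) * (1 + \<alpha>\<^sup>2) + 2 * \<alpha>) / (1 + \<beta>)"
    and "\<gamma>\<^sub>2 = (1 - \<alpha>) * (2 + (1 + \<alpha>) * (1 + 2 * \<beta>)) / (1 + \<beta>)"
  shows "(A_numrad A T) ^ 4
    \<le> \<gamma>\<^sub>1 / 16 * (A_opnorm A (\<lambda>x. A_adjoint A T (T x) + T (A_adjoint A T x)))\<^sup>2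
      + \<gamma>\<^sub>2 / 8 * A_opnorm A (\<lambda>x. A_adjoint A T (T x) + T (A_adjoint A T x)) * A_numrad A (T ^^ 2)"
proof -
  define N where "N = A_opnorm A (\<lambda>x. A_adjoint A T (T x) + T (A_adjoint A T x))"
  define W where "W = A_numrad A (T ^^ 2)"
  have "bounded_clinear T"
    using assms(3) by (simp add: A_adjointable_def)
  note bounds = A_numrad_square_bounds[OF assms(2) this A_inner_A_adjoint[OF assms(2,3)],
      folded N_def W_def]
  have "(A_numrad A T) ^ 4 = ((A_numrad A T)\<^sup>2)\<^sup>2"
    by simp
  also have "\<dots> \<le> (N / 4 + W / 2)\<^sup>2"
    using bounds(1) by (intro power_mono) auto
  also have "\<dots> \<le> \<gamma>\<^sub>1 * (N / 4)\<^sup>2 + \<gamma>\<^sub>2 * (N / 4) * (W / 2)"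
    using bounds(2,3) assms(4-7) by (intro interpolated_square_bound[of _ _ \<alpha> \<beta>]) auto
  also have "\<dots> = \<gamma>\<^sub>1 / 16 * N\<^sup>2 + \<gamma>\<^sub>2 / 8 * N * W"
    by (simp add: power_divide)
  finally show ?thesis
    unfolding N_def W_def .
qed

end
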